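(* Let $T:X\to X$ be a continuous mapping on a non-empty separable complete metric space $X$. Then the following assertions are equivalent: (a) for any non-empty open subset $V$ of $X$ there is some $\delta >0$ such that for any non-empty open subset $U$ of $X$ there is some $x\in U$ such that $\overline{\mathrm{dens}}\,\{n\geq 0 : T^n x\in V\} >\delta$; (b) for any non-empty open subset $V$ of $X$ there is some $\delta>0$ such that for any non-empty open subset $U$ of $X$ and any $n\geq 0$ there are some $x\in U$ and $N\geq n$ such that $$\frac{1}{N+1}\mathrm{card}\{k\leq N : T^k x\in V\}>\delta;$$ (c) $T$ is upper frequently hypercyclic. In that case the set $UFHC(T)$ of upper frequently hypercyclic points for $T$ is residual in $X$.
   Context: For $A\subset\mathbb{N}_0=\{0,1,2,\ldots\}$ the upper density is $\overline{\mathrm{dens}}\, A = \limsup_{N\to\infty} \frac{1}{N+1}\mathrm{card} (A \cap [0,N])$. In (b), $k$ ranges over integers $0\le k\le N$. A continuous mapping $T:X\to X$ is called upper frequently hypercyclic if there exists a point $x\in X$ such that, for any non-empty open set $U$ in $X$, $\overline{\mathrm{dens}}\,\{n\geq 0 : T^nx\in U\}>0$; such a point $x$ is called upper frequently hypercyclic for $T$, and the set of such points is $UFHC(T)$. A subset of $X$ is residual if it contains a countable intersection of dense open subsets of $X$. *)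

theory Defs
  imports "HOL-Analysis.Analysis"
begin

(* The value lies in [0,1]; it is taken in ereal only because limsup needs a
   complete linear order. *)
definition upper_density :: "nat set \<Rightarrow> ereal" where
  "upper_density A = limsup (\<lambda>N. ereal (1 / (real N + 1) * real (card (A \<inter> {0..N}))))"

definition upper_frequently_hypercyclic_point ::
    "('a::topological_space \<Rightarrow> 'a) \<Rightarrow> 'a \<Rightarrow> bool" where
  "upper_frequently_hypercyclic_point T x \<longleftrightarrow>
     (\<forall>U. open U \<and> U \<noteq> {} \<longrightarrow> upper_density {n. (T ^^ n) x \<in> U} > 0)"

definition UFHC :: "('a::topological_space \<Rightarrow> 'a) \<Rightarrow> 'a set" where
  "UFHC T = {x. upper_frequently_hypercyclic_point T x}"

definition upper_frequently_hypercyclic :: "('a::topological_space \<Rightarrow> 'a) \<Rightarrow> bool" where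
  "upper_frequently_hypercyclic T \<longleftrightarrow>
     continuous_on UNIV T \<and> (\<exists>x. upper_frequently_hypercyclic_point T x)"

definition residual :: "'a::topological_space set \<Rightarrow> bool" where
  "residual A \<longleftrightarrow>
     (\<exists>\<G>. countable \<G> \<and> (\<forall>G\<in>\<G>. open G \<and> closure G = UNIV) \<and> \<Inter>\<G> \<subseteq> A)"

end

theory Submission
  imports Defs
begin

text \<open>
  The proof is a Baire category argument. For a non-empty open set \<open>V\<close>, the points whose orbit
  visits \<open>V\<close> with frequency above \<open>\<delta>\<close> up to some time \<open>N \<ge> n\<close> form an open set, because finitely
  many visits to \<open>V\<close> survive a small perturbation of the starting point
  (\<open>open_frequent_visits\<close>). Condition (b) says that, for a \<open>\<delta>\<close> depending on \<open>V\<close> only, all these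
  sets are dense. A point in all of them, for fixed \<open>V\<close> and every \<open>n\<close>, visits \<open>V\<close> with upper
  density at least \<open>\<delta>\<close>. Since the space is separable, countably many sets \<open>V\<close> suffice
  (\<open>separable_imp_countable_pi_base\<close>), and (b) makes the set of upper frequently hypercyclic points
  residual
  (\<open>residual_UFHC_if_visits_uniformly_frequent\<close>); completeness then makes it non-empty, which is
  (c).

  Conversely, an upper frequently hypercyclic point has a dense orbit, and every point of that
  orbit visits \<open>V\<close> with at least the same upper density, since discarding an initial segment of
  the times does not lower it (\<open>upper_density_le_shift\<close>). So one \<open>\<delta>\<close> serves all open sets \<open>U\<close>,
  which is (a).
  Finally (a) gives (b) because a limit superior above \<open>\<delta>\<close> is exceeded at arbitrarily late times.
\<close>

section \<open>Upper density\<close>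

definition visit_freq :: "nat set \<Rightarrow> nat \<Rightarrow> real" where
  "visit_freq A N = 1 / (real N + 1) * real (card {k. k \<le> N \<and> k \<in> A})"

lemma visit_freq_mono:
  assumes "A \<subseteq> B"
  shows "visit_freq A N \<le> visit_freq B N"
proof -
  have "card {k. k \<le> N \<and> k \<in> A} \<le> card {k. k \<le> N \<and> k \<in> B}"
    using assms by (intro card_mono) auto
  then show ?thesis
    unfolding visit_freq_def by (intro mult_left_mono) auto
qed

lemma upper_density_eq_limsup: "upper_density A = limsup (\<lambda>N. ereal (visit_freq A N))"
proof -
  have "A \<inter> {0..N} = {k. k \<le> N \<and> k \<in> A}" for N
    by auto
  then show ?thesis
    by (simp add: upper_density_def visit_freq_def)
qed

lemma upper_density_mono: "A \<subseteq> B \<Longrightarrow> upper_density A \<le> upper_density B"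
  unfolding upper_density_eq_limsup by (intro Limsup_mono) (simp add: visit_freq_mono)

lemma frequently_visit_freq_greater:
  assumes "upper_density A > ereal \<delta>"
  shows "\<exists>N\<ge>n. visit_freq A N > \<delta>"
proof (rule ccontr)
  assume "\<not> ?thesis"
  then have "\<forall>\<^sub>F N in sequentially. ereal (visit_freq A N) \<le> ereal \<delta>"
    by (auto simp: eventually_sequentially not_less)
  then have "upper_density A \<le> ereal \<delta>"
    unfolding upper_density_eq_limsup by (rule Limsup_bounded)
  with assms show False
    by simp
qed

lemma upper_density_geI:
  assumes "\<And>n. \<exists>N\<ge>n. visit_freq A N > \<delta>"
  shows "upper_density A \<ge> ereal \<delta>"
proof (rule ccontr)
  assume "\<not> ?thesis"
  then have "\<forall>\<^sub>F N in sequentially. ereal (visit_freq A N) < ereal \<delta>"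
    unfolding upper_density_eq_limsup by (intro Limsup_lessD) simp
  then obtain n where "\<And>N. N \<ge> n \<Longrightarrow> visit_freq A N < \<delta>"
    by (auto simp: eventually_sequentially)
  with assms[of n] show False
    by (meson less_asym)
qed

text \<open>
  The times before \<open>n\<close> contribute at most \<open>n\<close> elements, hence at most \<open>n / (N + 1)\<close> to the
  frequency up to time \<open>N\<close>, and this vanishes in the limit.
\<close>

lemma upper_density_le_shift: "upper_density A \<le> upper_density {k. k + n \<in> A}"
proof -
  let ?B = "{k. k + n \<in> A}"
  have freq: "visit_freq A N \<le> real n / (real N + 1) + visit_freq ?B N" for N
  proof -
    have "{k. k \<le> N \<and> k \<in> A} \<subseteq> {..<n} \<union> (\<lambda>k. k + n) ` {k. k \<le> N \<and> k \<in> ?B}"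
    proof
      fix k assume k: "k \<in> {k. k \<le> N \<and> k \<in> A}"
      show "k \<in> {..<n} \<union> (\<lambda>k. k + n) ` {k. k \<le> N \<and> k \<in> ?B}"
      proof (cases "k < n")
        case False
        with k show ?thesis
          by (intro UnI2 image_eqI[of _ _ "k - n"]) auto
      qed simp
    qed
    then have "card {k. k \<le> N \<and> k \<in> A}
        \<le> card ({..<n} \<union> (\<lambda>k. k + n) ` {k. k \<le> N \<and> k \<in> ?B})"
      by (intro card_mono) auto
    also have "\<dots> \<le> card {..<n} + card ((\<lambda>k. k + n) ` {k. k \<le> N \<and> k \<in> ?B})"
      by (rule card_Un_le)
    also have "\<dots> \<le> n + card {k. k \<le> N \<and> k \<in> ?B}"
      using card_image_le[of "{k. k \<le> N \<and> k \<in> ?B}" "\<lambda>k. k + n"] by simp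
    finally have "real (card {k. k \<le> N \<and> k \<in> A}) \<le> real n + real (card {k. k \<le> N \<and> k \<in> ?B})"
      by linarith
    then show ?thesis
      by (simp add: visit_freq_def divide_simps)
  qed
  have "(\<lambda>N. real n / (real N + 1)) \<longlonglongrightarrow> 0"
    using tendsto_mult[OF tendsto_const[of "real n"] LIMSEQ_inverse_real_of_nat]
    by (simp add: divide_inverse add.commute)
  then have vanish: "(\<lambda>N. ereal (real n / (real N + 1))) \<longlonglongrightarrow> 0"
    by (simp add: zero_ereal_def)
  have "upper_density A \<le> limsup (\<lambda>N. ereal (real n / (real N + 1)) + ereal (visit_freq ?B N))"
    unfolding upper_density_eq_limsup using freq by (intro Limsup_mono) simp
  also have "\<dots> = upper_density ?B"
    unfolding upper_density_eq_limsup by (subst ereal_limsup_lim_add[OF vanish]) simp_all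
  finally show ?thesis .
qed

section \<open>Visits of an orbit to an open set\<close>

definition return_times :: "('a \<Rightarrow> 'a) \<Rightarrow> 'a set \<Rightarrow> 'a \<Rightarrow> nat set" where
  "return_times T V x = {k. (T ^^ k) x \<in> V}"

lemma open_vimage_funpow:
  fixes T :: "'a::topological_space \<Rightarrow> 'a"
  assumes "continuous_on UNIV T" "open V"
  shows "open {x. (T ^^ k) x \<in> V}"
proof -
  have "continuous_on UNIV (T ^^ k)"
  proof (induction k)
    case (Suc k)
    have "continuous_on UNIV (T \<circ> (T ^^ k))"
      by (rule continuous_on_compose[OF Suc]) (rule continuous_on_subset[OF assms(1)], simp)
    then show ?case
      by simp
  qed (simp add: continuous_on_id id_def)
  then show ?thesis
    using open_vimage[OF assms(2)] by (simp add: vimage_def)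
qed

text \<open>
  Near a point \<open>x\<close>, the finitely many visits of \<open>x\<close> to \<open>V\<close> up to time \<open>N\<close> persist, so the number of
  visits up to time \<open>N\<close> can only increase: the visiting frequency is lower semicontinuous.
\<close>

lemma open_frequent_visits:
  fixes T :: "'a::topological_space \<Rightarrow> 'a"
  assumes "continuous_on UNIV T" "open V"
  shows "open {x. \<exists>N\<ge>n. visit_freq (return_times T V x) N > \<delta>}"
proof (subst open_subopen, rule ballI)
  fix x assume "x \<in> {x. \<exists>N\<ge>n. visit_freq (return_times T V x) N > \<delta>}"
  then obtain N where N: "N \<ge> n" "visit_freq (return_times T V x) N > \<delta>"
    by auto
  define K where "K = {k. k \<le> N \<and> k \<in> return_times T V x}"
  let ?W = "\<Inter>k\<in>K. {y. (T ^^ k) y \<in> V}"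
  have "open ?W"
    using open_vimage_funpow[OF assms] by (intro open_INT) (auto simp: K_def)
  moreover have "x \<in> ?W"
    by (auto simp: K_def return_times_def)
  moreover have "visit_freq (return_times T V y) N > \<delta>" if "y \<in> ?W" for y
  proof -
    have "visit_freq (return_times T V x) N = visit_freq K N"
      by (simp add: visit_freq_def K_def)
    also have "\<dots> \<le> visit_freq (return_times T V y) N"
      using that by (intro visit_freq_mono) (auto simp: return_times_def)
    finally show ?thesis
      using N by simp
  qed
  ultimately show "\<exists>W. open W \<and> x \<in> W \<and> W \<subseteq> {x. \<exists>N\<ge>n. visit_freq (return_times T V x) N > \<delta>}"
    using N(1) by (intro exI[of _ ?W]) blast
qed

section \<open>Upper frequently hypercyclic points\<close>

lemma upper_frequently_hypercyclic_point_return_times: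
  "upper_frequently_hypercyclic_point T x \<longleftrightarrow>
    (\<forall>U. open U \<and> U \<noteq> {} \<longrightarrow> upper_density (return_times T U x) > 0)"
  by (simp add: upper_frequently_hypercyclic_point_def return_times_def)

text \<open>
  The orbit meets \<open>U\<close>, and from the point where it does so it visits \<open>V\<close> with at least the upper
  density of the original orbit.
\<close>

lemma upper_frequently_hypercyclic_point_imp_dense_visits:
  fixes T :: "'a::topological_space \<Rightarrow> 'a"
  assumes x: "upper_frequently_hypercyclic_point T x"
    and U: "open U" "U \<noteq> {}"
  shows "\<exists>y\<in>U. upper_density (return_times T V y) \<ge> upper_density (return_times T V x)"
proof -
  have "return_times T U x \<noteq> {}"
  proof
    assume "return_times T U x = {}"
    then have "upper_density (return_times T U x) = 0"
      by (simp add: upper_density_def Limsup_const zero_ereal_def)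
    moreover have "upper_density (return_times T U x) > 0"
      using x U unfolding upper_frequently_hypercyclic_point_return_times by blast
    ultimately show False
      by simp
  qed
  then obtain n where "(T ^^ n) x \<in> U"
    by (auto simp: return_times_def)
  moreover have "return_times T V ((T ^^ n) x) = {k. k + n \<in> return_times T V x}"
    by (simp add: return_times_def funpow_add)
  ultimately show ?thesis
    using upper_density_le_shift by metis
qed

text \<open>
  Small balls around the points of a countable dense set serve as \<open>\<B>\<close>. A family such that every
  non-empty open set contains a member (a pi-base) is enough to test upper frequent hypercyclicity:
  the visits to a subset of \<open>U\<close> are visits to \<open>U\<close>, and upper density is monotone.
\<close>

lemma separable_imp_countable_pi_base:
  assumes "separable_space (euclidean :: 'a::metric_space topology)"
  obtains \<B> :: "'a::metric_space set set" where "countable \<B>" "\<And>V. V \<in> \<B> \<Longrightarrow> open V \<and> V \<noteq> {}"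
    "\<And>U. open U \<Longrightarrow> U \<noteq> {} \<Longrightarrow> \<exists>V\<in>\<B>. V \<subseteq> U"
proof -
  obtain C :: "'a set" where C: "countable C" "closure C = UNIV"
    using assms by (auto simp: separable_space_def)
  define \<B> where "\<B> = (\<lambda>(c, m). ball c (inverse (real (Suc m)))) ` (C \<times> UNIV)"
  show ?thesis
  proof
    show "countable \<B>"
      using C by (auto simp: \<B>_def)
    show "open V \<and> V \<noteq> {}" if "V \<in> \<B>" for V
      using that by (auto simp: \<B>_def)
    show "\<exists>V\<in>\<B>. V \<subseteq> U" if U: "open U" "U \<noteq> {}" for U
    proof -
      have "U \<inter> C \<noteq> {}"
        using U C open_Int_closure_eq_empty[of U C] by auto
      then obtain c where "c \<in> C" "c \<in> U"
        by auto
      then obtain e where c: "c \<in> C" "e > 0" "ball c e \<subseteq> U"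
        using U(1) openE by metis
      obtain m where "inverse (real (Suc m)) < e"
        using reals_Archimedean[OF c(2)] by auto
      then have "ball c (inverse (real (Suc m))) \<subseteq> U"
        using c(3) subset_ball[of "inverse (real (Suc m))" e c] by auto
      with c(1) show ?thesis
        by (force simp: \<B>_def)
    qed
  qed
qed

text \<open>
  The bound \<open>\<delta>\<close> must not depend on \<open>U\<close>: for one \<open>\<delta>\<close> per target set \<open>V\<close>, the points that visit \<open>V\<close>
  with frequency above \<open>\<delta>\<close> up to some time \<open>N \<ge> n\<close> meet every \<open>U\<close>, so they form a dense open set.
  Letting \<open>V\<close> range over a countable family and \<open>n\<close> over the naturals gives a countable intersection, all
  of whose points visit each \<open>V\<close> of the family with upper density at least \<open>\<delta> > 0\<close>.
\<close>

lemma residual_UFHC_if_visits_uniformly_frequent: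
  fixes T :: "'a::metric_space \<Rightarrow> 'a"
  assumes separable: "separable_space (euclidean :: 'a topology)"
    and continuous: "continuous_on UNIV T"
    and frequent: "\<And>V. open V \<Longrightarrow> V \<noteq> {} \<Longrightarrow>
      \<exists>\<delta>>0. \<forall>U n. open U \<and> U \<noteq> {} \<longrightarrow>
        (\<exists>x\<in>U. \<exists>N\<ge>n. visit_freq (return_times T V x) N > \<delta>)"
  shows "residual (UFHC T)"
proof -
  obtain \<B> :: "'a set set" where \<B>: "countable \<B>"
    "\<And>V. V \<in> \<B> \<Longrightarrow> open V \<and> V \<noteq> {}"
    "\<And>U. open U \<Longrightarrow> U \<noteq> {} \<Longrightarrow> \<exists>V\<in>\<B>. V \<subseteq> U"
    using separable_imp_countable_pi_base[OF separable] by blast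
  have "\<forall>V\<in>\<B>. \<exists>\<delta>>0. \<forall>U n. open U \<and> U \<noteq> {} \<longrightarrow>
        (\<exists>x\<in>U. \<exists>N\<ge>n. visit_freq (return_times T V x) N > \<delta>)"
    using \<B>(2) by (intro ballI frequent) auto
  then obtain \<delta> where \<delta>: "\<And>V. V \<in> \<B> \<Longrightarrow> \<delta> V > 0"
    "\<And>V U n. V \<in> \<B> \<Longrightarrow> open U \<Longrightarrow> U \<noteq> {} \<Longrightarrow>
      \<exists>x\<in>U. \<exists>N\<ge>n. visit_freq (return_times T V x) N > \<delta> V"
    by metis
  define G where "G V n = {x. \<exists>N\<ge>n. visit_freq (return_times T V x) N > \<delta> V}" for V and n :: nat
  define \<G> where "\<G> = (\<lambda>(V, n). G V n) ` (\<B> \<times> UNIV)"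
  have "countable \<G>"
    using \<B>(1) by (auto simp: \<G>_def)
  moreover have "open (G V n) \<and> closure (G V n) = UNIV" if "V \<in> \<B>" for V n
  proof
    show "open (G V n)"
      unfolding G_def using \<B>(2)[OF that] by (intro open_frequent_visits continuous) simp
    have "U \<inter> G V n \<noteq> {}" if "open U" "U \<noteq> {}" for U
      using \<delta>(2)[OF \<open>V \<in> \<B>\<close> that, of n] by (auto simp: G_def)
    then have "- closure (G V n) = {}"
      using closure_subset[of "G V n"] by (meson closed_closure disjoint_iff open_Compl ComplD
          subsetD)
    then show "closure (G V n) = UNIV"
      by auto
  qed
  moreover have "\<Inter>\<G> \<subseteq> UFHC T"
  proof
    fix x assume x: "x \<in> \<Inter>\<G>"
    have "upper_density (return_times T U x) > 0" if U: "open U" "U \<noteq> {}" for U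
    proof -
      obtain V where V: "V \<in> \<B>" "V \<subseteq> U"
        using \<B>(3)[OF U] by auto
      have "x \<in> G V n" for n
        using x V(1) by (auto simp: \<G>_def)
      then have "ereal (\<delta> V) \<le> upper_density (return_times T V x)"
        by (intro upper_density_geI) (auto simp: G_def)
      also have "\<dots> \<le> upper_density (return_times T U x)"
        using V(2) by (intro upper_density_mono) (auto simp: return_times_def)
      finally show ?thesis
        using \<delta>(1)[OF V(1)] by (auto intro: less_le_trans[of 0 "ereal (\<delta> V)"])
    qed
    then show "x \<in> UFHC T"
      by (simp add: UFHC_def upper_frequently_hypercyclic_point_return_times)
  qed
  ultimately show ?thesis
    unfolding residual_def by (intro exI[of _ \<G>]) (auto simp: \<G>_def)
qed

lemma residual_imp_nonempty:
  fixes A :: "'a::complete_space set"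
  assumes "residual A"
  shows "A \<noteq> {}"
proof -
  obtain \<G> :: "'a set set" where \<G>: "countable \<G>" "\<forall>G\<in>\<G>. open G \<and> closure G = UNIV" "\<Inter>\<G> \<subseteq> A"
    using assms by (auto simp: residual_def)
  have "Met_TC.mcomplete TYPE('a)"
    by (simp add: complete_UNIV)
  then have "euclidean closure_of \<Inter>\<G> = (UNIV :: 'a set)"
    using Met_TC.metric_Baire_category[of \<G>] \<G> by simp
  then show ?thesis
    using \<G>(3) by auto
qed

theorem corollary18:
  fixes T :: "'a::complete_space \<Rightarrow> 'a"
  assumes separable: "separable_space (euclidean :: 'a topology)"
    and continuous: "continuous_on UNIV T"
  defines "cond_a \<equiv>
      (\<forall>V. open V \<and> V \<noteq> {} \<longrightarrow>
        (\<exists>\<delta>::real. \<delta> > 0 \<and>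
          (\<forall>U. open U \<and> U \<noteq> {} \<longrightarrow>
            (\<exists>x\<in>U. upper_density {n. (T ^^ n) x \<in> V} > ereal \<delta>))))"
    and "cond_b \<equiv>
      (\<forall>V. open V \<and> V \<noteq> {} \<longrightarrow>
        (\<exists>\<delta>::real. \<delta> > 0 \<and>
          (\<forall>U n. open U \<and> U \<noteq> {} \<longrightarrow>
            (\<exists>x\<in>U. \<exists>N::nat. N \<ge> n \<and>
              1 / (real N + 1) * real (card {k. k \<le> N \<and> (T ^^ k) x \<in> V}) > \<delta>))))"
    and "cond_c \<equiv> upper_frequently_hypercyclic T"
  shows "(cond_a \<longleftrightarrow> cond_b) \<and> (cond_b \<longleftrightarrow> cond_c) \<and> (cond_c \<longrightarrow> residual (UFHC T))"
proof -
  have cond_a: "cond_a \<longleftrightarrow> (\<forall>V. open V \<and> V \<noteq> {} \<longrightarrow> (\<exists>\<delta>>0. \<forall>U. open U \<and> U \<noteq> {} \<longrightarrow>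
      (\<exists>x\<in>U. upper_density (return_times T V x) > ereal \<delta>)))"
    unfolding cond_a_def return_times_def by (rule refl)
  have cond_b: "cond_b \<longleftrightarrow> (\<forall>V. open V \<and> V \<noteq> {} \<longrightarrow> (\<exists>\<delta>>0. \<forall>U n. open U \<and> U \<noteq> {} \<longrightarrow>
      (\<exists>x\<in>U. \<exists>N\<ge>n. visit_freq (return_times T V x) N > \<delta>)))"
    unfolding cond_b_def return_times_def visit_freq_def mem_Collect_eq by (rule refl)
  have a_imp_b: cond_b if a: cond_a
    unfolding cond_b
  proof (intro allI impI)
    fix V :: "'a set" assume "open V \<and> V \<noteq> {}"
    then obtain \<delta> where \<delta>: "\<delta> > 0" "\<And>U. open U \<Longrightarrow> U \<noteq> {} \<Longrightarrow>
        \<exists>x\<in>U. upper_density (return_times T V x) > ereal \<delta>"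
      using a unfolding cond_a by metis
    have "\<exists>x\<in>U. \<exists>N\<ge>n. visit_freq (return_times T V x) N > \<delta>" if "open U" "U \<noteq> {}" for U n
      using \<delta>(2)[OF that] by (auto intro: frequently_visit_freq_greater)
    with \<delta>(1) show "\<exists>\<delta>>0. \<forall>U n. open U \<and> U \<noteq> {} \<longrightarrow>
        (\<exists>x\<in>U. \<exists>N\<ge>n. visit_freq (return_times T V x) N > \<delta>)"
      by (intro exI[of _ \<delta>]) simp
  qed
  have b_imp_residual: "residual (UFHC T)" if cond_b
    using that unfolding cond_b
    by (intro residual_UFHC_if_visits_uniformly_frequent separable continuous) blast
  have b_imp_c: cond_c if cond_b
    using residual_imp_nonempty[OF b_imp_residual[OF that]] continuous
    by (auto simp: cond_c_def upper_frequently_hypercyclic_def UFHC_def)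
  have c_imp_a: cond_a if c: cond_c
    unfolding cond_a
  proof (intro allI impI)
    fix V :: "'a set" assume V: "open V \<and> V \<noteq> {}"
    obtain x where x: "upper_frequently_hypercyclic_point T x"
      using c by (auto simp: cond_c_def upper_frequently_hypercyclic_def)
    then have "0 < upper_density (return_times T V x)"
      using V by (simp add: upper_frequently_hypercyclic_point_return_times)
    then obtain \<delta> where \<delta>: "0 < ereal \<delta>" "ereal \<delta> < upper_density (return_times T V x)"
      using ereal_dense2 by metis
    have "\<exists>y\<in>U. upper_density (return_times T V y) > ereal \<delta>" if "open U" "U \<noteq> {}" for U
      using upper_frequently_hypercyclic_point_imp_dense_visits[OF x that, of V] less_le_trans[OF \<delta>(2)]
      by blast
    with \<delta>(1) show "\<exists>\<delta>>0. \<forall>U. open U \<and> U \<noteq> {} \<longrightarrow>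
        (\<exists>x\<in>U. upper_density (return_times T V x) > ereal \<delta>)"
      by (intro exI[of _ \<delta>]) simp
  qed
  show ?thesis
    using a_imp_b b_imp_c c_imp_a b_imp_residual by blast
qed

end
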